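(* Let $\mathbb{F}$ be a field with $\operatorname{char}(\mathbb{F})\neq 2,3$. The Matsuo algebra $M_{1/2}(\mathcal{P}_3)$ over $\mathbb{F}$ is isomorphic to the Jordan algebra $\mathcal{H}_3(E,* )$.
   Context: $\mathcal{P}_3$ is the affine plane of order $3$: its points are the $9$ elements of $\mathbb{F}_3^2$ and its lines are the $12$ affine lines, each with $3$ points. For distinct points $x,y$, $x\wedge y$ denotes the third point of the line through $x$ and $y$. The Matsuo algebra $M_{1/2}(\mathcal{P}_3)$ is the commutative, not necessarily associative $\mathbb{F}$-algebra with basis the points of $\mathcal{P}_3$ and multiplication $xx=x$ and $xy=\frac14(x+y-x\wedge y)$ for distinct points $x,y$. $E=\mathbb{F}[x]/(x^2+3)$ is the quadratic étale extension of $\mathbb{F}$ (possibly not a field), $\sigma$ is its nontrivial $\mathbb{F}$-automorphism (sending the class $\zeta$ of $x$ to $-\zeta$), and $\mathcal{H}_3(E,* )$ is the $\mathbb{F}$-space of $3\times 3$ matrices over $E$ fixed by $(x_{ij})^*=(x_{ji}^\sigma)$, with Jordan product $x\bullet y=\frac12(xy+yx)$. *)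

theory Defs
  imports "HOL-Analysis.Analysis" "HOL-Computational_Algebra.Polynomial"
begin

section \<open>The affine plane of order 3 and its Matsuo algebra\<close>

text \<open>The numeral type \<open>3\<close> carries the ring structure of the integers modulo 3, so it
  serves as the field with three elements.\<close>

type_synonym point = "3 ^ 2"

definition affine_lines :: "point set set" where
  "affine_lines = {range (\<lambda>t. a + t *s v) | a v. v \<noteq> 0}"

text \<open>Meaningful only for distinct points.\<close>

definition third_point :: "point \<Rightarrow> point \<Rightarrow> point" where
  "third_point x y = (THE z. z \<noteq> x \<and> z \<noteq> y \<and> (\<exists>L\<in>affine_lines. {x, y, z} \<subseteq> L))"

lemma third_point_eq:
  assumes "x \<noteq> y"
  shows "third_point x y = - x - y"
    and "\<exists>!z. z \<noteq> x \<and> z \<noteq> y \<and> (\<exists>L\<in>affine_lines. {x, y, z} \<subseteq> L)"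
proof -
  have three: "t = 0 \<or> t = 1 \<or> t = 2" for t :: 3
    using exhaust_3[of t] by auto
  have three_w: "t + t + t = 0" for t :: 3
    using three[of t] by auto
  have triple: "w + w + w = 0" for w :: point
    by (simp only: vec_eq_iff vector_add_component three_w zero_index) simp
  have triple3: "3 * w = 0" for w :: point
    using triple[of w] by simp
  have range3: "range (\<lambda>t. a + t *s v) = {a, a + v, a + v + v}" for a v :: point
  proof -
    have U: "UNIV = {0, 1, 2::3}" using three by auto
    have "0 *s v = 0" "1 *s v = v" "2 *s v = v + v"
      by (simp_all add: vec_eq_iff)
    then show ?thesis
      unfolding U by (simp only: image_insert image_empty add_0_right add.assoc)
  qed
  have uniq: "z = - x - y"
    if z: "z \<noteq> x" "z \<noteq> y" "L \<in> affine_lines" "{x, y, z} \<subseteq> L" for z L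
  proof -
    from z obtain a v where L: "L = {a, a + v, a + v + v}"
      unfolding affine_lines_def range3 by blast
    have "x + y + z = a + (a + v) + (a + v + v)"
      using z assms unfolding L by (auto simp: algebra_simps)
    also have "\<dots> = (a + a + a) + (v + v + v)" by (simp add: algebra_simps)
    finally have "x + y + z = 0" by (simp add: triple3)
    then show ?thesis by (simp add: algebra_simps eq_neg_iff_add_eq_0)
  qed
  have "{x, y, - x - y} \<subseteq> range (\<lambda>t. x + t *s (y - x))"
  proof -
    have "- x - y = x + (y - x) + (y - x)"
      using triple[of y] triple[of x] by (simp add: algebra_simps eq_neg_iff_add_eq_0)
    then show ?thesis unfolding range3 by auto
  qed
  moreover have "range (\<lambda>t. x + t *s (y - x)) \<in> affine_lines"
    unfolding affine_lines_def using assms by (intro CollectI exI conjI) (rule refl, simp)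
  moreover have "- x - y \<noteq> x"
  proof
    assume "- x - y = x"
    then have "x - y = x + x + x" by (simp add: algebra_simps)
    then show False using assms by (simp only: triple) simp
  qed
  moreover have "- x - y \<noteq> y"
  proof
    assume "- x - y = y"
    moreover have "y - x = (- x - y) + y + y" by (simp only: diff_add_cancel) simp
    ultimately have "y - x = y + y + y" by simp
    then show False using assms by (simp only: triple) simp
  qed
  ultimately have ex: "- x - y \<noteq> x \<and> - x - y \<noteq> y \<and> (\<exists>L\<in>affine_lines. {x, y, - x - y} \<subseteq> L)"
    by blast
  show "third_point x y = - x - y"
    unfolding third_point_def using ex uniq by (intro the_equality) blast+
  show "\<exists>!z. z \<noteq> x \<and> z \<noteq> y \<and> (\<exists>L\<in>affine_lines. {x, y, z} \<subseteq> L)"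
    using ex uniq by (intro ex1I[of _ "- x - y"]) blast+
qed

text \<open>The underlying space of the Matsuo algebra is the space of coordinate vectors indexed
  by points; the point \<open>x\<close> is identified with \<open>axis x 1\<close>.\<close>

type_synonym 'a matsuo = "'a ^ point"

definition matsuo_basis_mult :: "point \<Rightarrow> point \<Rightarrow> 'a::field matsuo" where
  "matsuo_basis_mult x y =
     (if x = y then axis x 1
      else (1/4) *s (axis x 1 + axis y 1 - axis (third_point x y) 1))"

definition matsuo_mult :: "'a::field matsuo \<Rightarrow> 'a matsuo \<Rightarrow> 'a matsuo" where
  "matsuo_mult f g = (\<Sum>x\<in>UNIV. \<Sum>y\<in>UNIV. (f $ x * g $ y) *s matsuo_basis_mult x y)"

lemma matsuo_mult_axis: "matsuo_mult (axis x 1) (axis y 1) = matsuo_basis_mult x y"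
proof -
  have "matsuo_mult (axis x 1) (axis y 1) =
      (\<Sum>a\<in>UNIV. if a = x then \<Sum>b\<in>UNIV. if b = y then matsuo_basis_mult a b else 0 else 0)"
    unfolding matsuo_mult_def by (intro sum.cong) (auto simp: axis_def if_distrib[of "\<lambda>c. c *s _"] cong: if_cong)
  then show ?thesis by simp
qed

section \<open>The quadratic extension and its hermitian matrices\<close>

text \<open>The type \<open>'a quad_ext\<close> is the quotient of the polynomial ring over \<open>'a\<close>
  by the ideal generated by \<open>x^2 + 3\<close>.\<close>

quotient_type (overloaded) 'a quad_ext =
  "'a::field poly" / "\<lambda>p q. [:3, 0, 1:] dvd (p - q)"
proof (intro equivpI reflpI sympI transpI)
  fix p q r :: "'a poly"
  show "[:3, 0, 1:] dvd (p - p)" by simp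
  show "[:3, 0, 1:] dvd (q - p)" if "[:3, 0, 1:] dvd (p - q)"
    using that by (metis dvd_minus_iff minus_diff_eq)
  show "[:3, 0, 1:] dvd (p - r)" if "[:3, 0, 1:] dvd (p - q)" "[:3, 0, 1:] dvd (q - r)"
    using dvd_add[OF that] by simp
qed

instantiation quad_ext :: (field) comm_ring_1
begin

lift_definition zero_quad_ext :: "'a quad_ext" is 0 .
lift_definition one_quad_ext :: "'a quad_ext" is 1 .

lift_definition plus_quad_ext :: "'a quad_ext \<Rightarrow> 'a quad_ext \<Rightarrow> 'a quad_ext" is "(+)"
  by (metis add_diff_add dvd_add)

lift_definition minus_quad_ext :: "'a quad_ext \<Rightarrow> 'a quad_ext \<Rightarrow> 'a quad_ext" is "(-)"
proof -
  fix p q r s :: "'a poly"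
  assume "[:3, 0, 1:] dvd (p - q)" "[:3, 0, 1:] dvd (r - s)"
  from dvd_diff[OF this] show "[:3, 0, 1:] dvd (p - r - (q - s))"
    by (simp add: algebra_simps)
qed

lift_definition uminus_quad_ext :: "'a quad_ext \<Rightarrow> 'a quad_ext" is uminus
  by (metis dvd_minus_iff minus_diff_minus)

lift_definition times_quad_ext :: "'a quad_ext \<Rightarrow> 'a quad_ext \<Rightarrow> 'a quad_ext" is "(*)"
proof -
  fix p q r s :: "'a poly"
  assume "[:3, 0, 1:] dvd (p - q)" "[:3, 0, 1:] dvd (r - s)"
  then have "[:3, 0, 1:] dvd ((p - q) * r + q * (r - s))"
    by (intro dvd_add dvd_mult dvd_mult2)
  then show "[:3, 0, 1:] dvd (p * r - q * s)"
    by (simp add: algebra_simps)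
qed

instance
proof
  show "(0::'a quad_ext) \<noteq> 1"
  proof transfer
    show "\<not> [:3, 0, 1:] dvd (0 - 1 :: 'a poly)"
    proof
      assume "[:3, 0, 1:] dvd (0 - 1 :: 'a poly)"
      from dvd_imp_degree_le[OF this] show False by simp
    qed
  qed
qed (transfer; simp add: algebra_simps)+

end

lift_definition quad_scale :: "'a::field \<Rightarrow> 'a quad_ext \<Rightarrow> 'a quad_ext" is smult
  by (metis dvd_smult smult_diff_right)

lift_definition zeta :: "'a::field quad_ext" is "[:0, 1:]" .

text \<open>The automorphism induced by the substitution of \<open>-x\<close> for \<open>x\<close>.\<close>

lift_definition quad_conj :: "'a::field quad_ext \<Rightarrow> 'a quad_ext" is "\<lambda>p. pcompose p [:0, -1:]"
proof -
  fix p q :: "'a poly"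
  assume "[:3, 0, 1:] dvd (p - q)"
  then obtain r where "p - q = [:3, 0, 1:] * r" by (elim dvdE)
  then have "pcompose p [:0, -1:] - pcompose q [:0, -1:] = [:3, 0, 1:] * pcompose r [:0, -1:]"
    by (simp only: pcompose_diff[symmetric] pcompose_mult) (simp add: pcompose_pCons)
  then show "[:3, 0, 1:] dvd (pcompose p [:0, -1:] - pcompose q [:0, -1:])" by (rule dvdI)
qed

lemma zeta_square: "zeta * zeta = (-3 :: 'a::field quad_ext)"
proof -
  have "zeta * zeta + (1 + 1 + 1) = (0 :: 'a quad_ext)"
    by transfer (simp add: one_pCons)
  then show ?thesis by (simp add: eq_neg_iff_add_eq_0)
qed

lemma quad_conj_zeta: "quad_conj zeta = - zeta"
  by transfer (simp add: pcompose_pCons)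

lemma quad_conj_add: "quad_conj (u + v) = quad_conj u + quad_conj v"
  by transfer (simp add: pcompose_add)

lemma quad_conj_mult: "quad_conj (u * v) = quad_conj u * quad_conj v"
  by transfer (simp add: pcompose_mult)

lemma quad_conj_scale: "quad_conj (quad_scale c u) = quad_scale c (quad_conj u)"
  by transfer (simp add: pcompose_smult)

definition conj_transpose :: "'a::field quad_ext ^ 3 ^ 3 \<Rightarrow> 'a quad_ext ^ 3 ^ 3" where
  "conj_transpose A = (\<chi> i j. quad_conj (A $ j $ i))"

definition hermitian3 :: "('a::field quad_ext ^ 3 ^ 3) set" where
  "hermitian3 = {A. conj_transpose A = A}"

definition mat_scale :: "'a::field \<Rightarrow> 'a quad_ext ^ 3 ^ 3 \<Rightarrow> 'a quad_ext ^ 3 ^ 3" where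
  "mat_scale c A = (\<chi> i j. quad_scale c (A $ i $ j))"

definition jordan_mult ::
    "'a::field quad_ext ^ 3 ^ 3 \<Rightarrow> 'a quad_ext ^ 3 ^ 3 \<Rightarrow> 'a quad_ext ^ 3 ^ 3" where
  "jordan_mult A B = mat_scale (1/2) (A ** B + B ** A)"

lemma vector_space_mat_scale: "vector_space mat_scale"
proof
  fix a b :: 'a and A B :: "'a quad_ext ^ 3 ^ 3"
  have *: "quad_scale a (u + v) = quad_scale a u + quad_scale a v"
    "quad_scale (a + b) u = quad_scale a u + quad_scale b u"
    "quad_scale a (quad_scale b u) = quad_scale (a * b) u" "quad_scale 1 u = u" for u v
    by (transfer; simp add: smult_add_left smult_add_right)+
  show "mat_scale a (A + B) = mat_scale a A + mat_scale a B"
    "mat_scale (a + b) A = mat_scale a A + mat_scale b A"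
    "mat_scale a (mat_scale b A) = mat_scale (a * b) A" "mat_scale 1 A = A"
    by (simp_all add: mat_scale_def vec_eq_iff *)
qed

lemma hermitian3_closed:
  assumes "A \<in> hermitian3" "B \<in> hermitian3"
  shows "A + B \<in> hermitian3" "mat_scale c A \<in> hermitian3" "jordan_mult A B \<in> hermitian3"
proof -
  have h: "quad_conj (A $ j $ i) = A $ i $ j" "quad_conj (B $ j $ i) = B $ i $ j" for i j
    using assms by (auto simp: hermitian3_def conj_transpose_def vec_eq_iff)
  show "A + B \<in> hermitian3" "mat_scale c A \<in> hermitian3" "jordan_mult A B \<in> hermitian3"
    by (simp_all add: hermitian3_def conj_transpose_def vec_eq_iff mat_scale_def jordan_mult_def
        quad_conj_scale quad_conj_add quad_conj_mult h matrix_matrix_mult_def sum_3 mult.commute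
        add.commute add.left_commute add.assoc)
qed

end

theory Submission
  imports Defs
begin

text \<open>Let \<open>\<omega> = (-1 + \<zeta>) / 2\<close>, a primitive cube root of unity in \<open>E\<close>. The isomorphism sends the
  point \<open>(i, k)\<close> to the projection \<open>1/2 v v*\<close>, where \<open>v\<close> has entries \<open>0\<close>, \<open>1\<close>, \<open>-\<omega>\<^sup>-\<^sup>k\<close> in the
  positions \<open>i\<close>, \<open>i + 1\<close>, \<open>i + 2\<close> modulo 3. The Jordan products of these nine projections, which
  form the Hesse configuration, are those of the points. Bijectivity is seen
  by recovering the nine coefficients of a vector from a hermitian matrix: the diagonal gives the
  sums over the classes of points with the same first coordinate, and the off-diagonal entries give the remaining discrete Fourier coefficients
  along these classes.\<close>

section \<open>Coordinates on the quadratic extension in the basis \<open>1\<close>,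
  \<open>zeta\<close>\<close>

lift_definition qpair :: "'a::field \<Rightarrow> 'a \<Rightarrow> 'a quad_ext" is "\<lambda>a b. [:a, b:]" .

text \<open>Remainders modulo \<open>x^2 + 3\<close> depend only on the class, so their coefficients
  give coordinates even when the extension is not a field.\<close>

lift_definition qre :: "'a::field quad_ext \<Rightarrow> 'a" is "\<lambda>p. coeff (p mod [:3, 0, 1:]) 0"
  by (simp flip: mod_eq_dvd_iff)

lift_definition qim :: "'a::field quad_ext \<Rightarrow> 'a" is "\<lambda>p. coeff (p mod [:3, 0, 1:]) 1"
  by (simp flip: mod_eq_dvd_iff)

lemma qre_qpair [simp]: "qre (qpair a b) = a" and qim_qpair [simp]: "qim (qpair a b) = b"
  by (transfer; simp add: mod_poly_less)+

lemma qpair_qre_qim [simp]: "qpair (qre u) (qim u) = u"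
proof transfer
  fix p :: "'a poly"
  let ?m = "[:3, 0, 1:] :: 'a poly"
  have "degree (p mod ?m) < 2"
    using degree_mod_less'[of ?m p] by (cases "p mod ?m = 0") auto
  then have "[:coeff (p mod ?m) 0, coeff (p mod ?m) 1:] = p mod ?m"
    by (auto simp: poly_eq_iff coeff_pCons coeff_eq_0 split: nat.splits)
  then show "?m dvd ([:coeff (p mod ?m) 0, coeff (p mod ?m) 1:] - p)"
    by (simp flip: mod_eq_dvd_iff)
qed

lemma quad_ext_eq_iff: "u = v \<longleftrightarrow> qre u = qre v \<and> qim u = qim v"
  by (metis qpair_qre_qim)

lemma quad_ext_cases: obtains a b where "u = qpair a b"
  by (metis qpair_qre_qim)

lemma qpair_arith:
  "qpair a b + qpair c d = qpair (a + c) (b + d)"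
  "qpair a b - qpair c d = qpair (a - c) (b - d)"
  "- qpair a b = qpair (- a) (- b)"
  "quad_scale c (qpair a b) = qpair (c * a) (c * b)"
  "quad_conj (qpair a b) = qpair a (- b)"
  by (transfer; simp add: pcompose_pCons)+

lemma qpair_mult: "qpair a b * qpair c d = qpair (a * c - 3 * (b * d)) (a * d + b * c)"
proof transfer
  fix a b c d :: 'a
  \<comment> \<open>The only term of degree 2 is \<open>b * d * x^2\<close>, so the quotient by
    \<open>x^2 + 3\<close> is the constant \<open>b * d\<close>.\<close>
  have "[:a, b:] * [:c, d:] - [:a * c - 3 * (b * d), a * d + b * c:] = [:3, 0, 1:] * [:b * d:]"
    by (simp add: algebra_simps)
  then show "[:3, 0, 1:] dvd ([:a, b:] * [:c, d:] - [:a * c - 3 * (b * d), a * d + b * c:])"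
    by (rule dvdI)
qed

lemma qpair_zero: "0 = qpair 0 0"
  by transfer simp

lemma qre_simps [simp]:
  "qre 0 = 0" "qre (u + v) = qre u + qre v" "qre (u - v) = qre u - qre v" "qre (- u) = - qre u"
  "qre (quad_scale c u) = c * qre u" "qre (quad_conj u) = qre u"
  "qre (u * v) = qre u * qre v - 3 * (qim u * qim v)"
  and qim_simps [simp]:
  "qim 0 = 0" "qim (u + v) = qim u + qim v" "qim (u - v) = qim u - qim v" "qim (- u) = - qim u"
  "qim (quad_scale c u) = c * qim u" "qim (quad_conj u) = - qim u"
  "qim (u * v) = qre u * qim v + qim u * qre v"
  by (cases u rule: quad_ext_cases, cases v rule: quad_ext_cases,
      simp add: qpair_arith qpair_mult qpair_zero)+

lemma CHAR_neq_imp_neq_zero: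
  assumes "prime p" "CHAR('a::field) \<noteq> p"
  shows "of_nat p \<noteq> (0::'a)"
proof
  assume "of_nat p = (0::'a)"
  then have "CHAR('a) dvd p"
    by (simp add: of_nat_eq_0_iff_char_dvd)
  with assms have "CHAR('a) = 1"
    by (auto simp: prime_nat_iff)
  then show False
    by simp
qed

lemma qre_one [simp]: "qre 1 = 1" and qim_one [simp]: "qim 1 = 0"
  by (transfer; simp add: mod_poly_less one_pCons)+

text \<open>Strips factors 2 from literals, so that \<open>simp\<close> can see that denominators do
  not vanish.\<close>

lemma numeral_Bit0_eq_0_iff:
  assumes "(2::'a::field) \<noteq> 0"
  shows "(numeral (Num.Bit0 n) :: 'a) = 0 \<longleftrightarrow> (numeral n :: 'a) = 0"
  using assms by (metis mult_2 mult_eq_0_iff numeral_Bit0)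

section \<open>Cube roots of unity and the nine projections\<close>

definition omega_pow :: "3 \<Rightarrow> 'a::field quad_ext" where
  "omega_pow k = qpair (if k = 0 then 1 else -1/2)
     (if k = 0 then 0 else if k = 1 then 1/2 else -1/2)"

lemma omega_pow_0 [simp]: "omega_pow 0 = 1"
  by (simp add: omega_pow_def quad_ext_eq_iff)

lemma omega_pow_add:
  assumes "(2::'a::field) \<noteq> 0"
  shows "omega_pow (k + l) = (omega_pow k * omega_pow l :: 'a quad_ext)"
  using exhaust_3[of k] exhaust_3[of l] assms
  by (auto simp: omega_pow_def quad_ext_eq_iff field_simps numeral_Bit0_eq_0_iff)

text \<open>For distinct \<open>k\<close> and \<open>l\<close>, the exponents \<open>k\<close>,
  \<open>l\<close>, \<open>- k - l\<close> are all the residues modulo 3, and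
  \<open>1 + \<omega> + \<omega>^2 = 0\<close>.\<close>

lemma omega_pow_sum:
  assumes "(2::'a::field) \<noteq> 0" "k \<noteq> l"
  shows "omega_pow (- k - l) = (- omega_pow k - omega_pow l :: 'a quad_ext)"
  using exhaust_3[of k] exhaust_3[of l] assms
  by (auto simp: omega_pow_def quad_ext_eq_iff field_simps)

text \<open>Since \<open>k - l\<close> is 1 or -1, the summands are \<open>\<omega>\<close> and its
  inverse. This gives the diagonal entries of products of matrices sharing the index
  \<open>i\<close>.\<close>

lemma omega_pow_ratio_sum:
  assumes "(2::'a::field) \<noteq> 0" "k \<noteq> l"
  shows "omega_pow k * omega_pow (- l) + omega_pow (- k) * omega_pow l = (- 1 :: 'a quad_ext)"
  using exhaust_3[of k] exhaust_3[of l] assms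
  by (auto simp: omega_pow_def quad_ext_eq_iff field_simps numeral_Bit0_eq_0_iff)

text \<open>This is \<open>v v*\<close>, without the factor \<open>1/2\<close>. Off the diagonal
  \<open>b - a\<close> is 1 or -1 modulo 3, so one formula covers both conjugate entries.\<close>

definition sic_mat :: "3 \<Rightarrow> 3 \<Rightarrow> 'a::field quad_ext ^ 3 ^ 3" where
  "sic_mat i k = (\<chi> a b. if a = i \<or> b = i then 0 else if a = b then 1
     else - omega_pow ((b - a) * k))"

text \<open>If the points agree, \<open>v* v = 2\<close> gives the square. If only
  \<open>i = j\<close>, the third matrix lies in the same 2 by 2 block and the vanishing sum of the
  cube roots applies. If \<open>i\<close> and \<open>j\<close> differ, the supports meet only in
  position \<open>- i - j\<close>, so each entry of a product is a single term.\<close>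

lemma sic_mat_mult:
  assumes "(2::'a::field) \<noteq> 0"
  shows "sic_mat i k ** sic_mat j l + sic_mat j l ** sic_mat i k =
    (if i = j \<and> k = l then sic_mat i k + sic_mat i k + (sic_mat i k + sic_mat i k)
     else sic_mat i k + sic_mat j l - sic_mat (- i - j) (- k - l) :: 'a quad_ext ^ 3 ^ 3)"
proof -
  \<comment> \<open>Index differences evaluate to 1 or 2; this turns an exponent
    \<open>2 * k\<close> into \<open>- k\<close>.\<close>
  have double: "2 * x = - x" for x :: 3
    using exhaust_3[of x] by auto
  note add = omega_pow_add[OF assms]
  have inv: "omega_pow x * omega_pow (- x) = (1 :: 'a quad_ext)" for x
    using add[of x "- x"] by simp
  have diff: "omega_pow (x - y) = (omega_pow x * omega_pow (- y) :: 'a quad_ext)" for x y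
    using add[of x "- y"] by simp
  have inv_l: "omega_pow (- x) * omega_pow x = (1 :: 'a quad_ext)" for x
    using inv[of x] by (simp only: mult.commute)
  have inv_a: "omega_pow x * (omega_pow (- x) * z) = z" "omega_pow (- x) * (omega_pow x * z) = z"
    for x and z :: "'a quad_ext"
    by (simp_all only: mult.assoc[symmetric] inv inv_l mult_1)
  consider "i = j" "k = l" | "i = j" "k \<noteq> l" | "i \<noteq> j" by blast
  then show ?thesis
  proof cases
    case 1
    then show ?thesis
      using exhaust_3[of j]
      by (elim disjE; simp add: vec_eq_iff forall_3 matrix_matrix_mult_def sum_3 sic_mat_def double
          inv inv_l)
  next
    case 2
    have s: "omega_pow (- k - l) = (- omega_pow k - omega_pow l :: 'a quad_ext)"
      "omega_pow (k + l) = (- omega_pow (- k) - omega_pow (- l) :: 'a quad_ext)"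
      "omega_pow (l + k) = (- omega_pow (- k) - omega_pow (- l) :: 'a quad_ext)"
      using omega_pow_sum[OF assms, of k l] omega_pow_sum[OF assms, of "- k" "- l"] 2
      by (simp_all add: add.commute[of l k])
    show ?thesis
      using exhaust_3[of j] 2 omega_pow_ratio_sum[OF assms 2(2)]
      by (elim disjE; simp add: vec_eq_iff forall_3 matrix_matrix_mult_def sum_3 sic_mat_def double s)
         (simp_all add: algebra_simps)
  next
    case 3
    then show ?thesis
      using exhaust_3[of i] exhaust_3[of j]
      by (elim disjE; simp add: vec_eq_iff forall_3 matrix_matrix_mult_def sum_3 sic_mat_def double
          inv inv_l inv_a add diff)
  qed
qed

definition sic_proj :: "point \<Rightarrow> 'a::field quad_ext ^ 3 ^ 3" where
  "sic_proj p = mat_scale (1/2) (sic_mat (p $ 1) (p $ 2))"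

text \<open>Conjugation inverts \<open>\<omega>\<close>, and transposition negates the exponent
  \<open>(b - a) * k\<close>.\<close>

lemma sic_proj_hermitian: "(sic_proj p :: 'a::field quad_ext ^ 3 ^ 3) \<in> hermitian3"
proof -
  have "quad_conj (omega_pow k) = (omega_pow (- k) :: 'a quad_ext)" for k
    using exhaust_3[of k] by (auto simp: omega_pow_def quad_ext_eq_iff)
  then have "quad_conj (omega_pow ((a - b) * k)) = (omega_pow ((b - a) * k) :: 'a quad_ext)"
    for a b k :: 3
    by (metis minus_diff_eq minus_mult_left)
  moreover have "quad_conj 0 = (0 :: 'a quad_ext)" "quad_conj 1 = (1 :: 'a quad_ext)"
    "quad_conj (- u) = - quad_conj u" for u :: "'a quad_ext"
    by (simp_all add: quad_ext_eq_iff)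
  ultimately have "(sic_mat i k :: 'a quad_ext ^ 3 ^ 3) \<in> hermitian3" for i k
    by (auto simp: hermitian3_def conj_transpose_def sic_mat_def vec_eq_iff)
  then show ?thesis
    unfolding sic_proj_def by (intro hermitian3_closed)
qed

section \<open>The linear map, its inverse and its multiplicativity\<close>

definition matsuo_hermitian :: "'a::field matsuo \<Rightarrow> 'a quad_ext ^ 3 ^ 3" where
  "matsuo_hermitian f = (\<Sum>p\<in>UNIV. mat_scale (f $ p) (sic_proj p))"

text \<open>Inverse Fourier transform of length 3. On the image of \<open>f\<close>, the diagonal
  terms give the sum of \<open>f\<close> over the class of \<open>i\<close>, and \<open>m\<close> is
  \<open>-1/2\<close> times the sum of \<open>f (i, l) \<omega>^l\<close> over \<open>l\<close>. The
  last bracket is \<open>qre (quad_conj w * m)\<close>; the factor 4 combines this 2 with that from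
  adding the conjugate term.\<close>

definition hermitian_matsuo :: "'a::field quad_ext ^ 3 ^ 3 \<Rightarrow> 'a matsuo" where
  "hermitian_matsuo A = (\<chi> p.
     (let i = p $ 1; m = A $ (i + 1) $ (i + 2); w = omega_pow (p $ 2) in
       qre (A $ (i + 1) $ (i + 1)) + qre (A $ (i + 2) $ (i + 2)) - qre (A $ i $ i)
       - 4 * (qre w * qre m + 3 * (qim w * qim m))) / 3)"

lemma sum_point: "(\<Sum>p\<in>UNIV. g p) = (\<Sum>i\<in>UNIV. \<Sum>k\<in>UNIV. g (vector [i, k] :: point))"
proof -
  have "(\<Sum>p\<in>UNIV. g p) = (\<Sum>(i, k)\<in>UNIV. g (vector [i, k] :: point))"
    by (rule sum.reindex_bij_witness[of _ "\<lambda>(i, k). vector [i, k]" "\<lambda>p. (p $ 1, p $ 2)"])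
       (auto simp: vec_eq_iff forall_2 intro!: arg_cong[where f = g])
  then show ?thesis
    by (simp add: sum.cartesian_product)
qed

lemma linear_matsuo_hermitian: "Vector_Spaces.linear (*s) mat_scale matsuo_hermitian"
proof -
  interpret vector_space mat_scale
    by (rule vector_space_mat_scale)
  interpret V: vector_space "(*s) :: 'a \<Rightarrow> 'a matsuo \<Rightarrow> 'a matsuo"
    by (rule vec.vector_space_axioms)
  show ?thesis
    by unfold_locales
       (simp_all add: matsuo_hermitian_def scale_left_distrib sum.distrib scale_sum_right)
qed

lemma matsuo_hermitian_axis: "matsuo_hermitian (axis p 1) = sic_proj p"
proof -
  interpret vector_space mat_scale
    by (rule vector_space_mat_scale)
  have "matsuo_hermitian (axis p 1) = (\<Sum>q\<in>UNIV. if q = p then sic_proj q else 0)"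
    unfolding matsuo_hermitian_def by (intro sum.cong) (auto simp: axis_def)
  then show ?thesis
    by simp
qed

lemma matsuo_hermitian_in_hermitian3: "matsuo_hermitian f \<in> hermitian3"
proof -
  have "(\<Sum>p\<in>S. mat_scale (f $ p) (sic_proj p)) \<in> hermitian3" for S
    using finite[of S]
  proof (induction S)
    case empty
    show ?case
      by (simp add: hermitian3_def conj_transpose_def vec_eq_iff quad_ext_eq_iff)
  qed (simp add: hermitian3_closed sic_proj_hermitian)
  then show ?thesis
    unfolding matsuo_hermitian_def .
qed

lemma jordan_mult_bilinear:
  "jordan_mult (A + B) C = jordan_mult A C + jordan_mult B C"
  "jordan_mult C (A + B) = jordan_mult C A + jordan_mult C B"
  "jordan_mult (mat_scale c A) B = mat_scale c (jordan_mult A B)"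
  "jordan_mult A (mat_scale c B) = mat_scale c (jordan_mult A B)"
  by (simp_all add: jordan_mult_def mat_scale_def matrix_matrix_mult_def vec_eq_iff sum_3
      quad_ext_eq_iff algebra_simps)

lemma sic_proj_mult:
  assumes "(2::'a::field) \<noteq> 0"
  shows "jordan_mult (sic_proj p) (sic_proj q) =
    (if p = q then sic_proj p
     else mat_scale (1/4) (sic_proj p + sic_proj q - sic_proj (- p - q)) :: 'a quad_ext ^ 3 ^ 3)"
proof -
  have eq: "p = q \<longleftrightarrow> p $ 1 = q $ 1 \<and> p $ 2 = q $ 2"
    by (simp add: vec_eq_iff forall_2)
  interpret vector_space "mat_scale :: 'a \<Rightarrow> _"
    by (rule vector_space_mat_scale)
  let ?S = "sic_mat (p $ 1) (p $ 2) :: 'a quad_ext ^ 3 ^ 3"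
  let ?T = "sic_mat (q $ 1) (q $ 2) :: 'a quad_ext ^ 3 ^ 3"
  have half: "1/2 * (1/2) = (1/4 :: 'a)" "1/4 + 1/4 = (1/2 :: 'a)" "1/2 + 1/2 = (1 :: 'a)"
    using assms by (simp_all add: field_simps numeral_Bit0_eq_0_iff)
  have "jordan_mult (sic_proj p) (sic_proj q) =
      mat_scale (1/2) (mat_scale (1/2) (mat_scale (1/2) (?S ** ?T + ?T ** ?S)))"
    unfolding sic_proj_def jordan_mult_bilinear by (simp only: jordan_mult_def)
  \<comment> \<open>Of the three halvings, two cancel the factor 4 of the square, which leaves the
    projection itself.\<close>
  moreover have "mat_scale (1/2) (mat_scale (1/2) (?S + ?S + (?S + ?S))) = ?S"
    by (simp only: scale_scale half scale_right_distrib scale_left_distrib[symmetric] scale_one)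
  moreover have "mat_scale (1/2) (mat_scale (1/2) X) = mat_scale (1/4) X"
    for X :: "'a quad_ext ^ 3 ^ 3"
    by (simp only: scale_scale half)
  ultimately show ?thesis
    unfolding sic_mat_mult[OF assms] eq[symmetric]
    by (simp only: sic_proj_def scale_right_distrib scale_right_diff_distrib scale_left_commute
        vector_minus_component split: if_split) simp
qed

lemma matsuo_hermitian_basis_mult:
  assumes "(2::'a::field) \<noteq> 0"
  shows "matsuo_hermitian (matsuo_basis_mult p q) =
    (jordan_mult (sic_proj p) (sic_proj q) :: 'a quad_ext ^ 3 ^ 3)"
proof -
  interpret Vector_Spaces.linear "(*s)" mat_scale "matsuo_hermitian :: 'a matsuo \<Rightarrow> _"
    by (rule linear_matsuo_hermitian)
  show ?thesis
    by (simp add: matsuo_basis_mult_def sic_proj_mult[OF assms] third_point_eq scale add diff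
        matsuo_hermitian_axis vs2.scale_right_distrib vs2.scale_right_diff_distrib)
qed

lemma jordan_mult_sum_left: "jordan_mult (\<Sum>i\<in>I. A i) B = (\<Sum>i\<in>I. jordan_mult (A i) B)"
  and jordan_mult_sum_right: "jordan_mult B (\<Sum>i\<in>I. A i) = (\<Sum>i\<in>I. jordan_mult B (A i))"
proof -
  have "jordan_mult 0 B = 0" "jordan_mult B 0 = 0"
    using jordan_mult_bilinear(1)[of 0 0 B] jordan_mult_bilinear(2)[of B 0 0] by simp_all
  then show "jordan_mult (\<Sum>i\<in>I. A i) B = (\<Sum>i\<in>I. jordan_mult (A i) B)"
    "jordan_mult B (\<Sum>i\<in>I. A i) = (\<Sum>i\<in>I. jordan_mult B (A i))"
    by (induction I rule: infinite_finite_induct) (simp_all add: jordan_mult_bilinear)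
qed

text \<open>Both sides are bilinear in \<open>f\<close> and \<open>g\<close>, so the identity on
  basis points suffices.\<close>

lemma matsuo_hermitian_mult:
  assumes "(2::'a::field) \<noteq> 0"
  shows "matsuo_hermitian (matsuo_mult f g) =
    (jordan_mult (matsuo_hermitian f) (matsuo_hermitian g) :: 'a quad_ext ^ 3 ^ 3)"
proof -
  interpret Vector_Spaces.linear "(*s)" mat_scale "matsuo_hermitian :: 'a matsuo \<Rightarrow> _"
    by (rule linear_matsuo_hermitian)
  have "matsuo_hermitian (matsuo_mult f g) =
      (\<Sum>p\<in>UNIV. \<Sum>q\<in>UNIV. mat_scale (f $ p * g $ q) (jordan_mult (sic_proj p) (sic_proj q)))"
    by (simp add: matsuo_mult_def sum scale matsuo_hermitian_basis_mult[OF assms])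
  also have "\<dots> = jordan_mult (matsuo_hermitian f) (matsuo_hermitian g)"
    unfolding matsuo_hermitian_def jordan_mult_sum_left
    by (simp add: jordan_mult_sum_right jordan_mult_bilinear vs2.scale_sum_right mult.commute)
  finally show ?thesis .
qed

section \<open>Bijectivity onto the hermitian matrices\<close>

lemma hermitian_matsuo_inverse:
  assumes "(2::'a::field) \<noteq> 0" "(3::'a) \<noteq> 0"
  shows "hermitian_matsuo (matsuo_hermitian f) = (f :: 'a matsuo)"
proof -
  have point: "vector [p $ 1, p $ 2] = p" for p :: point
    by (simp add: vec_eq_iff forall_2)
  have "(9::'a) \<noteq> 0"
    using power_not_zero[OF assms(2), of 2] by simp
  then have "\<forall>i k. hermitian_matsuo (matsuo_hermitian f) $ vector [i, k] = f $ vector [i, k]"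
    unfolding forall_3
    by (intro conjI;
        simp add: hermitian_matsuo_def matsuo_hermitian_def sum_point sum_3 mat_scale_def
        sic_proj_def sic_mat_def omega_pow_def;
        simp add: field_simps assms numeral_Bit0_eq_0_iff)
  then show ?thesis
    by (metis point vec_eq_iff)
qed

lemma matsuo_hermitian_inverse:
  assumes "(2::'a::field) \<noteq> 0" "(3::'a) \<noteq> 0" "A \<in> hermitian3"
  shows "matsuo_hermitian (hermitian_matsuo A) = (A :: 'a quad_ext ^ 3 ^ 3)"
proof -
  \<comment> \<open>Powers of 3 that remain in the denominators once factors 2 are stripped.\<close>
  have nz: "(9::'a) \<noteq> 0" "(27::'a) \<noteq> 0" "(729::'a) \<noteq> 0"
    using power_not_zero[OF assms(2), of 2] power_not_zero[OF assms(2), of 3]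
      power_not_zero[OF assms(2), of 6] by simp_all
  have herm: "qre (A $ j $ i) = qre (A $ i $ j)" "qim (A $ j $ i) = - qim (A $ i $ j)" for i j
    using assms(3) unfolding hermitian3_def conj_transpose_def
    by (auto simp: vec_eq_iff quad_ext_eq_iff)
  have im0: "qim (A $ i $ i) = 0" for i
    using herm(2)[of i i] assms(1) by (simp add: eq_neg_iff_add_eq_0 flip: mult_2)
  \<comment> \<open>The cyclic indices \<open>i + 1\<close> and \<open>i + 2\<close> can evaluate to
    4 and 5.\<close>
  have mod3: "4 = (1::3)" "5 = (2::3)"
    by simp_all
  show ?thesis
    unfolding vec_eq_iff forall_3
    \<comment> \<open>The instances of \<open>herm\<close> rewrite towards the entries
      \<open>(1, 2)\<close>, \<open>(2, 3)\<close>, \<open>(3, 1)\<close>, which are those that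
      \<open>hermitian_matsuo\<close> reads; the general rule would loop.\<close>
    by (intro conjI;
        simp add: hermitian_matsuo_def matsuo_hermitian_def sum_point sum_3 mat_scale_def
        sic_proj_def sic_mat_def omega_pow_def quad_ext_eq_iff im0 mod3 Let_def
        herm[where i = 1 and j = 2] herm[where i = 2 and j = 3] herm[where i = 3 and j = 1];
        simp add: field_simps assms nz numeral_Bit0_eq_0_iff)
qed

theorem theorem4p5:
  assumes "CHAR('a::field) \<noteq> 2" and "CHAR('a) \<noteq> 3"
  shows "\<exists>\<phi> :: 'a matsuo \<Rightarrow> 'a quad_ext ^ 3 ^ 3.
           Vector_Spaces.linear (*s) mat_scale \<phi> \<and>
           bij_betw \<phi> UNIV hermitian3 \<and>
           (\<forall>x y. \<phi> (matsuo_mult x y) = jordan_mult (\<phi> x) (\<phi> y))"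
proof (intro exI conjI allI)
  have nz: "(2::'a) \<noteq> 0" "(3::'a) \<noteq> 0"
    using CHAR_neq_imp_neq_zero[of 2] CHAR_neq_imp_neq_zero[of 3] assms by simp_all
  show "Vector_Spaces.linear (*s) mat_scale (matsuo_hermitian :: 'a matsuo \<Rightarrow> _)"
    by (rule linear_matsuo_hermitian)
  show "bij_betw (matsuo_hermitian :: 'a matsuo \<Rightarrow> _) UNIV hermitian3"
    using nz
    by (intro bij_betw_byWitness[where f' = hermitian_matsuo])
       (auto simp: hermitian_matsuo_inverse matsuo_hermitian_inverse matsuo_hermitian_in_hermitian3)
  show "matsuo_hermitian (matsuo_mult x y) = jordan_mult (matsuo_hermitian x) (matsuo_hermitian y)"
    for x y :: "'a matsuo"
    by (rule matsuo_hermitian_mult[OF nz(1)])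
qed

end
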